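(* Let $(A,\circ,[\cdot,\cdot])$ be a finite-dimensional GD algebra over $\Bbbk$. Let $\operatorname{Der}_s(A)$ be the set of all $D\in\operatorname{End}(A)$ such that $D$ is a derivation of both $(A,\circ)$ and $(A,[\cdot,\cdot])$ and $D(x)\circ y=D(y)\circ x$ for all $x,y\in A$. On the vector space $A\rtimes\operatorname{Der}_s(A)$ (the direct sum of $A$ and $\operatorname{Der}_s(A)$) define $[x+f,y+g]:=[x,y]+f(y)-g(x)+fg-gf$ and $(x+f)\circ(y+g):=x\circ y$ for all $x,y\in A$ and $f,g\in\operatorname{Der}_s(A)$. Then $(A\rtimes\operatorname{Der}_s(A),\circ,[\cdot,\cdot])$ is a GD algebra.
   Context: $\Bbbk$ is an algebraically closed field of characteristic $0$. A Novikov algebra is a vector space with a bilinear product $\circ$ satisfying $(x\circ y)\circ z-x\circ(y\circ z)=(y\circ x)\circ z-y\circ(x\circ z)$ and $(x\circ y)\circ z=(x\circ z)\circ y$. A Gelfand--Dorfman (GD) algebra is a triple $(A,\circ,[\cdot,\cdot])$ such that $(A,\circ)$ is a Novikov algebra, $(A,[\cdot,\cdot])$ is a Lie algebra, and for all $x,y,z\in A$: $[x,y\circ z]-[z,y\circ x]+[y,x]\circ z-[y,z]\circ x-y\circ[x,z]=0$. *)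

theory Defs
  imports
    "HOL-Library.Function_Algebras"
    "HOL-Library.Product_Plus"
    "HOL-Computational_Algebra.Polynomial"
begin

text \<open>
  All structures below live on a subspace V of an ambient vector space; the operations are total
  functions on the ambient type, of which only the values on V matter. An abstract algebra is the
  case V = UNIV. Subspaces are needed because \<open>Der\<^sub>s\<close> depends on the two operations and therefore
  cannot be a type.
\<close>

locale algebra_on = vector_space scale
  for scale :: "'k::field \<Rightarrow> 'v::ab_group_add \<Rightarrow> 'v" +
  fixes V :: "'v set"
    and mul :: "'v \<Rightarrow> 'v \<Rightarrow> 'v"
  assumes subspace_V: "subspace V"
    and closed: "\<lbrakk>x \<in> V; y \<in> V\<rbrakk> \<Longrightarrow> mul x y \<in> V"
    and add_left: "\<lbrakk>x \<in> V; y \<in> V; z \<in> V\<rbrakk> \<Longrightarrow> mul (x + y) z = mul x z + mul y z"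
    and add_right: "\<lbrakk>x \<in> V; y \<in> V; z \<in> V\<rbrakk> \<Longrightarrow> mul x (y + z) = mul x y + mul x z"
    and smult_left: "\<lbrakk>x \<in> V; y \<in> V\<rbrakk> \<Longrightarrow> mul (scale c x) y = scale c (mul x y)"
    and smult_right: "\<lbrakk>x \<in> V; y \<in> V\<rbrakk> \<Longrightarrow> mul x (scale c y) = scale c (mul x y)"

locale novikov_algebra = algebra_on scale V circ
  for scale :: "'k::field \<Rightarrow> 'v::ab_group_add \<Rightarrow> 'v"
    and V :: "'v set"
    and circ :: "'v \<Rightarrow> 'v \<Rightarrow> 'v"  (infixl \<open>\<odot>\<close> 70) +
  assumes left_symmetric: "\<lbrakk>x \<in> V; y \<in> V; z \<in> V\<rbrakk> \<Longrightarrow>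
      (x \<odot> y) \<odot> z - x \<odot> (y \<odot> z) = (y \<odot> x) \<odot> z - y \<odot> (x \<odot> z)"
    and right_commutative: "\<lbrakk>x \<in> V; y \<in> V; z \<in> V\<rbrakk> \<Longrightarrow> (x \<odot> y) \<odot> z = (x \<odot> z) \<odot> y"

locale lie_algebra = algebra_on scale V bracket
  for scale :: "'k::field \<Rightarrow> 'v::ab_group_add \<Rightarrow> 'v"
    and V :: "'v set"
    and bracket :: "'v \<Rightarrow> 'v \<Rightarrow> 'v" +
  assumes alternating: "x \<in> V \<Longrightarrow> bracket x x = 0"
    and jacobi: "\<lbrakk>x \<in> V; y \<in> V; z \<in> V\<rbrakk> \<Longrightarrow>
      bracket x (bracket y z) + bracket y (bracket z x) + bracket z (bracket x y) = 0"

locale GD_algebra = novikov_algebra scale V circ + lie: lie_algebra scale V bracket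
  for scale :: "'k::field \<Rightarrow> 'v::ab_group_add \<Rightarrow> 'v"
    and V :: "'v set"
    and circ :: "'v \<Rightarrow> 'v \<Rightarrow> 'v"  (infixl \<open>\<odot>\<close> 70)
    and bracket :: "'v \<Rightarrow> 'v \<Rightarrow> 'v" +
  assumes compatible: "\<lbrakk>x \<in> V; y \<in> V; z \<in> V\<rbrakk> \<Longrightarrow>
      bracket x (y \<odot> z) - bracket z (y \<odot> x) + bracket y x \<odot> z - bracket y z \<odot> x
        - y \<odot> bracket x z = 0"

definition is_derivation ::
    "('k::field \<Rightarrow> 'a::ab_group_add \<Rightarrow> 'a) \<Rightarrow> ('a \<Rightarrow> 'a \<Rightarrow> 'a) \<Rightarrow> ('a \<Rightarrow> 'a) \<Rightarrow> bool" where
  "is_derivation scale mul D \<longleftrightarrow>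
     Vector_Spaces.linear scale scale D \<and> (\<forall>x y. D (mul x y) = mul (D x) y + mul x (D y))"

definition Der_s ::
    "('k::field \<Rightarrow> 'a::ab_group_add \<Rightarrow> 'a) \<Rightarrow> ('a \<Rightarrow> 'a \<Rightarrow> 'a) \<Rightarrow> ('a \<Rightarrow> 'a \<Rightarrow> 'a) \<Rightarrow> ('a \<Rightarrow> 'a) set" where
  "Der_s scale circ bracket =
     {D. is_derivation scale circ D \<and> is_derivation scale bracket D \<and>
         (\<forall>x y. circ (D x) y = circ (D y) x)}"

text \<open>The element \<open>x + f\<close> of the semidirect sum is the pair \<open>(x, f)\<close>.\<close>

fun semidirect_scale ::
    "('k::field \<Rightarrow> 'a::ab_group_add \<Rightarrow> 'a) \<Rightarrow> 'k \<Rightarrow> 'a \<times> ('a \<Rightarrow> 'a) \<Rightarrow> 'a \<times> ('a \<Rightarrow> 'a)" where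
  "semidirect_scale scale c (x, f) = (scale c x, \<lambda>y. scale c (f y))"

definition semidirect_carrier ::
    "('k::field \<Rightarrow> 'a::ab_group_add \<Rightarrow> 'a) \<Rightarrow> ('a \<Rightarrow> 'a \<Rightarrow> 'a) \<Rightarrow> ('a \<Rightarrow> 'a \<Rightarrow> 'a) \<Rightarrow>
     ('a \<times> ('a \<Rightarrow> 'a)) set" where
  "semidirect_carrier scale circ bracket = UNIV \<times> Der_s scale circ bracket"

fun semidirect_circ ::
    "('a::ab_group_add \<Rightarrow> 'a \<Rightarrow> 'a) \<Rightarrow> 'a \<times> ('a \<Rightarrow> 'a) \<Rightarrow> 'a \<times> ('a \<Rightarrow> 'a) \<Rightarrow> 'a \<times> ('a \<Rightarrow> 'a)" where
  "semidirect_circ circ (x, f) (y, g) = (circ x y, 0)"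

fun semidirect_bracket ::
    "('a::ab_group_add \<Rightarrow> 'a \<Rightarrow> 'a) \<Rightarrow> 'a \<times> ('a \<Rightarrow> 'a) \<Rightarrow> 'a \<times> ('a \<Rightarrow> 'a) \<Rightarrow> 'a \<times> ('a \<Rightarrow> 'a)" where
  "semidirect_bracket bracket (x, f) (y, g) = (bracket x y + f y - g x, (f \<circ> g) - (g \<circ> f))"

end

theory Submission
  imports Defs
begin

text \<open>
  Every axiom splits along the two summands. The operators form a Lie algebra under the commutator,
  and \<open>\<circ>\<close> ignores the operator parts of its arguments. What is left is the vector component of each
  identity, which is the same identity in \<open>A\<close> plus correction terms. In the Jacobi identity the
  corrections cancel because the operators are derivations of the bracket. In the compatibility
  identity for \<open>x + f\<close>, \<open>y + g\<close>, \<open>z + h\<close> they are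
  \<open>f (y \<circ> z) - f y \<circ> z - y \<circ> f z\<close>, minus the same expression with \<open>h, x\<close> in place of \<open>f, z\<close>,
  plus \<open>g x \<circ> z - g z \<circ> x\<close>. The first two vanish by the Leibniz rule, and the last is exactly what
  the symmetry condition \<open>g x \<circ> z = g z \<circ> x\<close> is made for.

  The point that needs an argument is that the symmetry condition survives commutators
  (\<open>commutator_symmetric\<close>).
\<close>

section \<open>Derivations of an algebra\<close>

lemma is_derivation_linearD:
  assumes "is_derivation scale mul D"
  shows "D (x + y) = D x + D y" "D (x - y) = D x - D y" "D 0 = 0"
    "D (scale c x) = scale c (D x)"
proof -
  interpret Vector_Spaces.linear scale scale D
    using assms by (simp add: is_derivation_def)
  show "D (x + y) = D x + D y" "D (x - y) = D x - D y" "D 0 = 0"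
    "D (scale c x) = scale c (D x)"
    by (fact add diff zero scale)+
qed

lemma is_derivation_leibnizD:
  "is_derivation scale mul D \<Longrightarrow> D (mul x y) = mul (D x) y + mul x (D y)"
  by (simp add: is_derivation_def)

lemma (in vector_space) is_derivationI:
  assumes "\<And>x y. D (x + y) = D x + D y" "\<And>c x. D (scale c x) = scale c (D x)"
    and "\<And>x y. D (mul x y) = mul (D x) y + mul x (D y)"
  shows "is_derivation scale mul D"
  using assms vector_space_axioms
  by (auto simp: is_derivation_def Vector_Spaces.linear_iff)

lemma additive_diff:
  fixes h :: "'a::ab_group_add \<Rightarrow> 'b::ab_group_add"
  assumes "\<And>x y. h (x + y) = h x + h y"
  shows "h (x - y) = h x - h y"
  using assms[of "x - y" y] by simp

context
  fixes scale :: "'k::field \<Rightarrow> 'a::ab_group_add \<Rightarrow> 'a" and mul :: "'a \<Rightarrow> 'a \<Rightarrow> 'a"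
  assumes alg: "algebra_on scale UNIV mul"
begin

interpretation algebra_on scale UNIV mul by (fact alg)

lemma mul_diff:
  "mul (x - y) z = mul x z - mul y z" "mul x (y - z) = mul x y - mul x z"
  by (rule additive_diff, simp add: add_left add_right)+

lemma mul_zero: "mul 0 z = 0" "mul x 0 = 0"
  using mul_diff(1)[of 0 0 z] mul_diff(2)[of x 0 0] by simp_all

lemma is_derivation_zero: "is_derivation scale mul 0"
  by (rule is_derivationI) (simp_all add: mul_zero)

lemma is_derivation_add:
  assumes "is_derivation scale mul f" "is_derivation scale mul g"
  shows "is_derivation scale mul (f + g)"
  by (rule is_derivationI)
    (simp_all add: is_derivation_linearD[OF assms(1)] is_derivation_linearD[OF assms(2)]
      is_derivation_leibnizD[OF assms(1)] is_derivation_leibnizD[OF assms(2)]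
      add_left add_right scale_right_distrib algebra_simps)

lemma is_derivation_scale:
  assumes "is_derivation scale mul f"
  shows "is_derivation scale mul (\<lambda>x. scale c (f x))"
  by (rule is_derivationI)
    (simp_all add: is_derivation_linearD[OF assms] is_derivation_leibnizD[OF assms]
      smult_left smult_right scale_right_distrib scale_left_commute)

lemma is_derivation_commutator:
  assumes "is_derivation scale mul f" "is_derivation scale mul g"
  shows "is_derivation scale mul ((f \<circ> g) - (g \<circ> f))"
  by (rule is_derivationI)
    (simp_all add: is_derivation_linearD[OF assms(1)] is_derivation_linearD[OF assms(2)]
      is_derivation_leibnizD[OF assms(1)] is_derivation_leibnizD[OF assms(2)]
      mul_diff scale_right_diff_distrib algebra_simps)

text \<open>
  Symmetry of \<open>f\<close> and of \<open>g\<close> turns the Leibniz expansion of \<open>f (g x \<circ> y)\<close> into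
  \<open>f (g x) \<circ> y + g (f y) \<circ> x\<close>. As \<open>g x \<circ> y = g y \<circ> x\<close>, this sum does not change when \<open>x\<close> and \<open>y\<close>
  are exchanged; rearranging the resulting equation gives the claim.
\<close>

lemma commutator_symmetric:
  assumes "is_derivation scale mul f"
    and f: "\<And>x y. mul (f x) y = mul (f y) x"
    and g: "\<And>x y. mul (g x) y = mul (g y) x"
  shows "mul (((f \<circ> g) - (g \<circ> f)) x) y = mul (((f \<circ> g) - (g \<circ> f)) y) x"
proof -
  have expand: "f (mul (g x) y) = mul (f (g x)) y + mul (g (f y)) x" for x y
    using is_derivation_leibnizD[OF assms(1), of "g x" y] g[of x "f y"] by simp
  have "mul (f (g x)) y + mul (g (f y)) x = mul (f (g y)) x + mul (g (f x)) y"
    using expand[of x y] expand[of y x] g[of x y] by simp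
  then show ?thesis
    by (simp add: mul_diff algebra_simps)
qed

end

section \<open>The semidirect sum\<close>

context
  fixes scale :: "'k::field \<Rightarrow> 'a::ab_group_add \<Rightarrow> 'a" and circ bracket :: "'a \<Rightarrow> 'a \<Rightarrow> 'a"
  assumes GD: "GD_algebra scale UNIV circ bracket"
begin

interpretation A: GD_algebra scale UNIV circ bracket by (fact GD)

lemmas circ_alg = A.algebra_on_axioms
lemmas bracket_alg = A.lie.algebra_on_axioms

lemma Der_sD:
  assumes "f \<in> Der_s scale circ bracket"
  shows "is_derivation scale circ f" "is_derivation scale bracket f"
    "circ (f x) y = circ (f y) x"
  using assms by (auto simp: Der_s_def)

lemma Der_sI:
  assumes "is_derivation scale circ f" "is_derivation scale bracket f"
    and "\<And>x y. circ (f x) y = circ (f y) x"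
  shows "f \<in> Der_s scale circ bracket"
  using assms by (auto simp: Der_s_def)

lemma Der_s_zero: "0 \<in> Der_s scale circ bracket"
  by (rule Der_sI)
    (simp_all add: is_derivation_zero[OF circ_alg] is_derivation_zero[OF bracket_alg]
      mul_zero[OF circ_alg])

lemma Der_s_add:
  assumes "f \<in> Der_s scale circ bracket" "g \<in> Der_s scale circ bracket"
  shows "f + g \<in> Der_s scale circ bracket"
proof (rule Der_sI)
  show "circ ((f + g) x) y = circ ((f + g) y) x" for x y
    using Der_sD(3)[OF assms(1), of x y] Der_sD(3)[OF assms(2), of x y] by (simp add: A.add_left)
qed (use assms in \<open>auto intro: is_derivation_add[OF circ_alg] is_derivation_add[OF bracket_alg] Der_sD\<close>)

lemma Der_s_scale:
  assumes "f \<in> Der_s scale circ bracket"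
  shows "(\<lambda>x. scale c (f x)) \<in> Der_s scale circ bracket"
proof (rule Der_sI)
  show "circ (scale c (f x)) y = circ (scale c (f y)) x" for x y
    using Der_sD(3)[OF assms, of x y] by (simp add: A.smult_left)
qed (use assms in \<open>auto intro: is_derivation_scale[OF circ_alg] is_derivation_scale[OF bracket_alg] Der_sD\<close>)

lemma Der_s_commutator:
  assumes f: "f \<in> Der_s scale circ bracket" and g: "g \<in> Der_s scale circ bracket"
  shows "(f \<circ> g) - (g \<circ> f) \<in> Der_s scale circ bracket"
proof (rule Der_sI)
  show "circ (((f \<circ> g) - (g \<circ> f)) x) y = circ (((f \<circ> g) - (g \<circ> f)) y) x" for x y
    by (rule commutator_symmetric[OF circ_alg Der_sD(1)[OF f] Der_sD(3)[OF f] Der_sD(3)[OF g]])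
qed (use f g in \<open>auto intro: is_derivation_commutator[OF circ_alg]
      is_derivation_commutator[OF bracket_alg] Der_sD\<close>)

lemma bracket_anticommute: "bracket y x = - bracket x y"
proof -
  have "bracket y x + bracket x y = bracket (x + y) (x + y)"
    using A.lie.alternating[of x] A.lie.alternating[of y]
    by (simp add: A.lie.add_left A.lie.add_right)
  also have "\<dots> = 0"
    by (simp add: A.lie.alternating)
  finally show ?thesis
    by (simp add: eq_neg_iff_add_eq_0)
qed

abbreviation "scale' \<equiv> semidirect_scale scale"
abbreviation "V \<equiv> semidirect_carrier scale circ bracket"
abbreviation "circ' \<equiv> semidirect_circ circ"
abbreviation "bracket' \<equiv> semidirect_bracket bracket"

lemma vector_space_semidirect: "vector_space scale'"
  by unfold_locales
    (auto simp: fun_eq_iff A.scale_right_distrib A.scale_left_distrib)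

interpretation S: vector_space scale' by (fact vector_space_semidirect)

lemma subspace_semidirect: "S.subspace V"
  by (rule S.subspaceI)
    (auto simp: semidirect_carrier_def zero_prod_def Der_s_zero Der_s_add Der_s_scale)

lemma algebra_on_semidirect_circ: "algebra_on scale' V circ'"
  by unfold_locales
    (use subspace_semidirect in \<open>auto simp: semidirect_carrier_def Der_s_zero
      A.add_left A.add_right A.smult_left A.smult_right fun_eq_iff\<close>)

lemma algebra_on_semidirect_bracket: "algebra_on scale' V bracket'"
proof
  show "S.subspace V" by (fact subspace_semidirect)
next
  fix X Y assume "X \<in> V" "Y \<in> V"
  then show "bracket' X Y \<in> V"
    by (cases X; cases Y) (simp add: semidirect_carrier_def Der_s_commutator)
next
  fix X Y Z assume V: "X \<in> V" "Y \<in> V" "Z \<in> V"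
  obtain x f y g z h where [simp]: "X = (x, f)" "Y = (y, g)" "Z = (z, h)"
    by (cases X; cases Y; cases Z)
  have der: "is_derivation scale bracket f" "is_derivation scale bracket g"
      "is_derivation scale bracket h"
    using V Der_sD(2) by (auto simp: semidirect_carrier_def)
  note lin = der[THEN is_derivation_linearD(1)]
  show "bracket' (X + Y) Z = bracket' X Z + bracket' Y Z"
    and "bracket' X (Y + Z) = bracket' X Y + bracket' X Z"
    by (auto simp: fun_eq_iff lin A.lie.add_left A.lie.add_right)
next
  fix X Y c assume V: "X \<in> V" "Y \<in> V"
  obtain x f y g where [simp]: "X = (x, f)" "Y = (y, g)"
    by (cases X; cases Y)
  have der: "is_derivation scale bracket f" "is_derivation scale bracket g"
    using V Der_sD(2) by (auto simp: semidirect_carrier_def)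
  note lin = der[THEN is_derivation_linearD(4)]
  show "bracket' (scale' c X) Y = scale' c (bracket' X Y)"
    and "bracket' X (scale' c Y) = scale' c (bracket' X Y)"
    by (auto simp: fun_eq_iff lin A.lie.smult_left A.lie.smult_right
        A.scale_right_distrib A.scale_right_diff_distrib)
qed

lemma novikov_algebra_semidirect: "novikov_algebra scale' V circ'"
proof (intro novikov_algebra.intro novikov_algebra_axioms.intro)
  show "algebra_on scale' V circ'" by (fact algebra_on_semidirect_circ)
next
  fix X Y Z :: "'a \<times> ('a \<Rightarrow> 'a)"
  obtain x f y g z h where [simp]: "X = (x, f)" "Y = (y, g)" "Z = (z, h)"
    by (cases X; cases Y; cases Z)
  show "circ' (circ' X Y) Z - circ' X (circ' Y Z) = circ' (circ' Y X) Z - circ' Y (circ' X Z)"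
    by (simp add: A.left_symmetric)
  show "circ' (circ' X Y) Z = circ' (circ' X Z) Y"
    by (simp add: A.right_commutative)
qed

lemma lie_algebra_semidirect: "lie_algebra scale' V bracket'"
proof (intro lie_algebra.intro lie_algebra_axioms.intro)
  show "algebra_on scale' V bracket'" by (fact algebra_on_semidirect_bracket)
next
  fix X :: "'a \<times> ('a \<Rightarrow> 'a)"
  show "bracket' X X = 0"
    by (cases X) (simp add: A.lie.alternating zero_prod_def)
next
  fix X Y Z assume V: "X \<in> V" "Y \<in> V" "Z \<in> V"
  obtain x f y g z h where [simp]: "X = (x, f)" "Y = (y, g)" "Z = (z, h)"
    by (cases X; cases Y; cases Z)
  have der: "is_derivation scale bracket f" "is_derivation scale bracket g"
      "is_derivation scale bracket h"
    using V Der_sD(2) by (auto simp: semidirect_carrier_def)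
  note lin = der[THEN is_derivation_linearD(1)] der[THEN is_derivation_linearD(2)]
  note leibniz = der[THEN is_derivation_leibnizD]
  have jac: "bracket x (bracket y z) + (bracket y (bracket z x) + bracket z (bracket x y)) = 0"
    using A.lie.jacobi[of x y z] by (simp add: add.assoc)
  \<comment> \<open>The six terms \<open>bracket u (D v)\<close> cancel against those that the Leibniz rule produces from
    \<open>D (bracket v w)\<close> once each of the latter is written with the derivative on the right.\<close>
  have swap: "bracket (f y) z = - bracket z (f y)" "bracket (g z) x = - bracket x (g z)"
    "bracket (h x) y = - bracket y (h x)"
    by (rule bracket_anticommute)+
  show "bracket' X (bracket' Y Z) + bracket' Y (bracket' Z X) + bracket' Z (bracket' X Y) = 0"
    using jac
    by (simp add: zero_prod_def fun_eq_iff lin leibniz swap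
        A.lie.add_right mul_diff[OF bracket_alg] algebra_simps)
qed

lemma GD_algebra_semidirect: "GD_algebra scale' V circ' bracket'"
proof (intro GD_algebra.intro GD_algebra_axioms.intro)
  show "novikov_algebra scale' V circ'" by (fact novikov_algebra_semidirect)
  show "lie_algebra scale' V bracket'" by (fact lie_algebra_semidirect)
next
  fix X Y Z assume V: "X \<in> V" "Y \<in> V" "Z \<in> V"
  obtain x f y g z h where [simp]: "X = (x, f)" "Y = (y, g)" "Z = (z, h)"
    by (cases X; cases Y; cases Z)
  have Der: "f \<in> Der_s scale circ bracket" "g \<in> Der_s scale circ bracket"
      "h \<in> Der_s scale circ bracket"
    using V by (auto simp: semidirect_carrier_def)
  have zero: "f 0 = 0" "h 0 = 0"
    using Der is_derivation_linearD(3) Der_sD(1) by metis+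
  have leibniz: "f (circ y z) = circ (f y) z + circ y (f z)"
    "h (circ y x) = circ (h y) x + circ y (h x)"
    using Der is_derivation_leibnizD Der_sD(1) by metis+
  have "circ (g x) z = circ (g z) x"
    using Der(2) by (rule Der_sD(3))
  with A.compatible[of x y z] show
    "bracket' X (circ' Y Z) - bracket' Z (circ' Y X) + circ' (bracket' Y X) Z
      - circ' (bracket' Y Z) X - circ' Y (bracket' X Z) = 0"
    by (simp add: zero_prod_def fun_eq_iff zero leibniz
        A.add_left A.add_right mul_diff[OF circ_alg] algebra_simps)
qed

end

theorem proposition5p8:
  fixes scale :: "'k::{alg_closed_field, field_char_0} \<Rightarrow> 'a::ab_group_add \<Rightarrow> 'a"
    and Basis :: "'a set"
    and circ bracket :: "'a \<Rightarrow> 'a \<Rightarrow> 'a"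
  assumes "finite_dimensional_vector_space scale Basis"
    and "GD_algebra scale UNIV circ bracket"
  shows "GD_algebra (semidirect_scale scale) (semidirect_carrier scale circ bracket)
           (semidirect_circ circ) (semidirect_bracket bracket)"
  using assms(2) by (rule GD_algebra_semidirect)

end
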